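(* Let $d$ be a positive integer. For every pair of real numbers $0<p<q$ and every $f\in C^{\infty}_{b,\mathrm{const}+}(\mathbb{R}^{d})$, $$I_{p}(f)\le\frac{\Gamma(1+1/q)}{\Gamma(1+1/q-p/q)}\,q^{p/q}\,I_{q}(f)^{p/q},$$ where $\Gamma$ is the gamma function.
   Context: $\gamma_{d}$ is the standard Gaussian measure on $\mathbb{R}^{d}$, i.e. $\frac{d\gamma_d}{dx}=(2\pi)^{-d/2}e^{-|x|^{2}/2}$, with $|\cdot|$ the Euclidean norm. For $r>0$ and measurable $f$ with $\int_{\mathbb{R}^d}|f|^r\,d\gamma_d<\infty$, $\|f\|_{r}:=\left\{\int_{\mathbb{R}^{d}}|f|^{r}\,d\gamma_{d}\right\}^{1/r}$ (also for $r<1$). $C^{\infty}_{b,\mathrm{const}+}(\mathbb{R}^{d})$ is the class of functions $f:\mathbb{R}^d\to\mathbb{R}$ that are the sum of a nonnegative function in $C^{\infty}_{b}(\mathbb{R}^{d})$ and a positive constant, where $C^{\infty}_{b}(\mathbb{R}^{d})$ is the class of real-valued bounded $C^{\infty}$-functions on $\mathbb{R}^{d}$ with bounded derivatives of all orders. For $r>0$ and $f\in C^{\infty}_{b,\mathrm{const}+}(\mathbb{R}^{d})$, $$I_{r}(f):=\frac{\|f\|_{r}^{r}-\|f\|_{1}^{r}}{r-1}\quad (r\neq 1),\qquad I_{1}(f):=\int_{\mathbb{R}^{d}}f\log\frac{f}{\|f\|_{1}}\,d\gamma_{d}.$$ *)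

theory Defs
  imports "HOL-Analysis.Analysis"
begin

definition std_gaussian :: "(real ^ 'n::finite) measure" where
  "std_gaussian = density lborel
     (\<lambda>x. ennreal ((2 * pi) powr (- real CARD('n) / 2) * exp (- (norm x)\<^sup>2 / 2)))"

definition gnorm :: "real \<Rightarrow> (real ^ 'n::finite \<Rightarrow> real) \<Rightarrow> real" where
  "gnorm r f = (\<integral>x. \<bar>f x\<bar> powr r \<partial>std_gaussian) powr (1 / r)"

definition partial_deriv ::
    "'n::finite \<Rightarrow> (real ^ 'n \<Rightarrow> real) \<Rightarrow> real ^ 'n \<Rightarrow> real" where
  "partial_deriv i f x = frechet_derivative f (at x) (axis i 1)"

fun C_k :: "nat \<Rightarrow> (real ^ 'n::finite \<Rightarrow> real) \<Rightarrow> bool" where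
  "C_k 0 f \<longleftrightarrow> continuous_on UNIV f"
| "C_k (Suc k) f \<longleftrightarrow> f differentiable_on UNIV \<and> (\<forall>i. C_k k (partial_deriv i f))"

(* A list of coordinate indices encodes an iterated partial derivative; the empty list
   gives f itself, so boundedness of f is included in Cb_infinity below. *)
fun iterated_partial ::
    "'n::finite list \<Rightarrow> (real ^ 'n \<Rightarrow> real) \<Rightarrow> real ^ 'n \<Rightarrow> real" where
  "iterated_partial [] f = f"
| "iterated_partial (i # is) f = partial_deriv i (iterated_partial is f)"

definition Cb_infinity :: "(real ^ 'n::finite \<Rightarrow> real) set" where
  "Cb_infinity = {f. (\<forall>k. C_k k f) \<and> (\<forall>is. bounded (range (iterated_partial is f)))}"

definition Cb_infinity_const_plus :: "(real ^ 'n::finite \<Rightarrow> real) set" where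
  "Cb_infinity_const_plus =
     {f. \<exists>g c. g \<in> Cb_infinity \<and> (\<forall>x. 0 \<le> g x) \<and> 0 < c \<and> f = (\<lambda>x. g x + c)}"

definition I_fun :: "real \<Rightarrow> (real ^ 'n::finite \<Rightarrow> real) \<Rightarrow> real" where
  "I_fun r f =
     (if r = 1 then \<integral>x. f x * ln (f x / gnorm 1 f) \<partial>std_gaussian
      else (gnorm r f powr r - gnorm 1 f powr r) / (r - 1))"

end

(*
  Let F = f / m with m the mean of f, and g_r(s) the integral of exp((r-1)t) over t in [0,s].
  Then I_r(f) = m^r E[F g_r(ln F)], where F is the density of a probability measure.  For p < q the
  function g_p is a concave function of g_q, so Jensen's inequality bounds I_p by g_p(u), where
  u >= 0 solves g_q(u) = I_q (after normalising m = 1).  Hoelder's inequality for exp(-t) dt on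
  [0,u], which has mass at most 1, gives g_p(u) <= g_q(u)^(p/q), hence I_p <= I_q^(p/q).
  By log-convexity of Gamma the constant in the theorem is at least 1.
*)

theory Submission
  imports Defs "HOL-Probability.Distributions"
begin

section \<open>Primitives of exponentials and their comparison\<close>

text \<open>The function g_r of the overview in closed form. The case \<open>r = 1\<close> fills the
  removable singularity and matches the case split in \<open>I_fun\<close>.\<close>

definition exp_primitive :: "real \<Rightarrow> real \<Rightarrow> real" where
  "exp_primitive r s = (if r = 1 then s else (exp ((r - 1) * s) - 1) / (r - 1))"

lemma exp_primitive_0_right [simp]: "exp_primitive r 0 = 0"
  by (simp add: exp_primitive_def)

lemma exp_primitive_0_left: "exp_primitive 0 s = 1 - exp (- s)"
  by (simp add: exp_primitive_def)

lemma exp_primitive_deriv: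
  "(exp_primitive r has_real_derivative exp ((r - 1) * s)) (at s)"
proof (cases "r = 1")
  case True
  then show ?thesis by (simp add: exp_primitive_def[abs_def])
next
  case False
  then show ?thesis
    unfolding exp_primitive_def[abs_def]
    by (auto intro!: derivative_eq_intros)
qed

lemma continuous_on_exp_primitive: "continuous_on A (exp_primitive r)"
  by (intro continuous_at_imp_continuous_on ballI DERIV_isCont[OF exp_primitive_deriv])

lemma exp_primitive_mono: "s \<le> t \<Longrightarrow> exp_primitive r s \<le> exp_primitive r t"
  by (rule DERIV_nonneg_imp_nondecreasing[of s t]) (use exp_primitive_deriv in fastforce)+

text \<open>The slope of \<open>exp_primitive p\<close> with respect to
  \<open>exp_primitive q\<close> at s is exp((p-q)s), which is nonincreasing. Concavity is stated as
  a tangent bound at \<open>u\<close>, so that Jensen's inequality reduces to integrating an affine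
  bound.\<close>

lemma exp_primitive_concave:
  assumes "p \<le> q"
  shows "exp_primitive p s \<le>
    exp_primitive p u + exp ((p - q) * u) * (exp_primitive q s - exp_primitive q u)"
proof -
  define h where "h = (\<lambda>s. exp ((p - q) * u) * exp_primitive q s - exp_primitive p s)"
  have h': "(h has_real_derivative
      exp ((q - 1) * s) * (exp ((p - q) * u) - exp ((p - q) * s))) (at s)" for s
  proof -
    have "exp ((p - 1) * s) = exp ((q - 1) * s) * exp ((p - q) * s)"
      by (simp add: exp_add [symmetric] algebra_simps)
    then show ?thesis
      unfolding h_def
      by (auto intro!: derivative_eq_intros exp_primitive_deriv simp: algebra_simps)
  qed
  \<comment> \<open>The derivative of \<open>h\<close> is nonpositive before \<open>u\<close> and
    nonnegative after it, so \<open>u\<close> is a global minimum.\<close>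
  have "h u \<le> h s"
  proof (cases "u \<le> s")
    case True
    show ?thesis
    proof (rule DERIV_nonneg_imp_nondecreasing[OF True], intro exI conjI)
      fix x assume "u \<le> x"
      then show "0 \<le> exp ((q - 1) * x) * (exp ((p - q) * u) - exp ((p - q) * x))"
        using assms by (simp add: mult_left_mono_neg)
    qed (rule h')
  next
    case False
    then have "s \<le> u" by simp
    then show ?thesis
    proof (rule DERIV_nonpos_imp_nonincreasing, intro exI conjI)
      fix x assume "x \<le> u"
      then show "exp ((q - 1) * x) * (exp ((p - q) * u) - exp ((p - q) * x)) \<le> 0"
        using assms by (intro mult_nonneg_nonpos) (simp_all add: mult_left_mono_neg)
    qed (rule h')
  qed
  then show ?thesis by (simp add: h_def algebra_simps)
qed

text \<open>Weighted AM-GM for \<open>y\<close> and \<open>l\<close>, multiplied by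
  \<open>l powr (a - 1)\<close>. The bound is affine in \<open>y\<close>, hence easy to
  integrate.\<close>

lemma powr_le_tangent:
  fixes a y l :: real
  assumes "0 \<le> a" "a \<le> 1" "0 < y" "0 < l"
  shows "y powr a \<le> a * l powr (a - 1) * y + (1 - a) * l powr a"
proof -
  have "l powr (a - 1) * (y powr a * l powr (1 - a)) \<le> l powr (a - 1) * (a * y + (1 - a) * l)"
    using Youngs_inequality_0[of a "1 - a" y l] assms by (intro mult_left_mono) auto
  then show ?thesis
    using assms by (simp add: powr_diff field_simps)
qed

text \<open>Hoelder's inequality for the sub-probability measure \<open>exp (- s) ds\<close> on \<open>[0, u]\<close>, by
  integrating a tangent line of the power function.\<close>

lemma exp_primitive_le_powr:
  assumes "0 < p" "p < q" "0 \<le> u"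
  shows "exp_primitive p u \<le> exp_primitive q u powr (p / q)"
proof (cases "exp_primitive q u = 0")
  case True
  \<comment> \<open>A tangent at \<open>l\<close> needs l > 0, so the zero case is separate: the
    tangent at 0 has slope 1.\<close>
  have "exp_primitive p u \<le> exp_primitive p 0 + exp ((p - q) * 0) * (exp_primitive q u - exp_primitive q 0)"
    by (rule exp_primitive_concave) (use assms in simp)
  then show ?thesis using True by simp
next
  case False
  define a where "a = p / q"
  define l where "l = exp_primitive q u"
  have a: "0 < a" "a < 1" "a * q = p" using assms by (simp_all add: a_def)
  have l: "0 < l"
    using exp_primitive_mono[OF assms(3), of q] False by (simp add: l_def)
  \<comment> \<open>\<open>h\<close> integrates exp(-t) times the gap between the tangent at
    \<open>l\<close> and the power \<open>a\<close>, taken at y = exp(qt). The linear term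
    integrates to \<open>exp_primitive q\<close>, the constant one to
    \<open>exp_primitive 0\<close>.\<close>
  define h where "h = (\<lambda>s. a * l powr (a - 1) * exp_primitive q s
    + (1 - a) * l powr a * exp_primitive 0 s - exp_primitive p s)"
  have "h 0 \<le> h u"
  proof (rule DERIV_nonneg_imp_nondecreasing[OF assms(3)], intro exI conjI)
    fix x :: real
    show "(h has_real_derivative a * l powr (a - 1) * exp ((q - 1) * x)
        + (1 - a) * l powr a * exp ((0 - 1) * x) - exp ((p - 1) * x)) (at x)"
      unfolding h_def by (auto intro!: derivative_eq_intros exp_primitive_deriv)
    have shift: "exp ((r - 1) * x) = exp (- x) * exp (r * x)" for r
      by (simp add: exp_add[symmetric] algebra_simps)
    have "exp (q * x) powr a \<le> a * l powr (a - 1) * exp (q * x) + (1 - a) * l powr a"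
      by (rule powr_le_tangent) (use a l in auto)
    moreover have "exp (q * x) powr a = exp (p * x)"
      using a by (simp add: powr_def mult.assoc[symmetric])
    ultimately have "exp (- x) * exp (p * x) \<le>
        exp (- x) * (a * l powr (a - 1) * exp (q * x) + (1 - a) * l powr a)"
      by (intro mult_left_mono) auto
    then show "0 \<le> a * l powr (a - 1) * exp ((q - 1) * x)
        + (1 - a) * l powr a * exp ((0 - 1) * x) - exp ((p - 1) * x)"
      unfolding shift[of p] shift[of q] by (simp add: algebra_simps)
  qed
  then have "exp_primitive p u \<le> a * l powr (a - 1) * l + (1 - a) * l powr a * (1 - exp (- u))"
    by (simp add: h_def l_def exp_primitive_0_left)
  \<comment> \<open>The mass 1 - exp(-u) of the weight is at most 1.\<close>
  also have "\<dots> \<le> a * l powr (a - 1) * l + (1 - a) * l powr a * 1"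
    using a l by (intro add_left_mono mult_left_mono) auto
  also have "\<dots> = l powr a"
    using l by (simp add: powr_diff algebra_simps)
  finally show ?thesis by (simp add: l_def a_def)
qed

section \<open>The Gamma factor\<close>

text \<open>Log-convexity of Gamma between x and 1 + x, combined with Gamma(1+x) = x Gamma(x). At x
  = 1/q and a = p/q it makes the constant of the theorem at least 1.\<close>

lemma Gamma_ratio_ge_powr:
  fixes x a :: real
  assumes "0 < x" "0 \<le> a" "a \<le> 1"
  shows "x powr a \<le> Gamma (1 + x) / Gamma (1 + x - a)"
proof -
  have G: "0 < Gamma x" "0 < Gamma (1 + x)" "0 < Gamma (1 + x - a)"
    using assms by (auto intro!: Gamma_real_pos)
  have "(ln \<circ> Gamma) ((1 - a) *\<^sub>R (1 + x) + a *\<^sub>R x)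
      \<le> (1 - a) * (ln \<circ> Gamma) (1 + x) + a * (ln \<circ> Gamma) x"
    by (rule convex_onD[OF log_convex_Gamma_real]) (use assms in auto)
  moreover have "(1 - a) *\<^sub>R (1 + x) + a *\<^sub>R x = 1 + x - a"
    by (simp add: algebra_simps)
  moreover have "Gamma (1 + x) = x * Gamma x"
    by (metis Gamma_plus1 add.commute assms(1) nonpos_Ints_nonpos not_less)
  then have "ln (Gamma (1 + x)) = ln x + ln (Gamma x)"
    using ln_mult_pos[OF assms(1) G(1)] by simp
  ultimately have "a * ln x \<le> ln (Gamma (1 + x)) - ln (Gamma (1 + x - a))"
    by (simp add: algebra_simps)
  also have "\<dots> = ln (Gamma (1 + x) / Gamma (1 + x - a))"
    using G by (simp add: ln_div)
  finally show ?thesis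
    using assms G by (simp add: powr_def ln_ge_iff)
qed

section \<open>The Gaussian measure\<close>

text \<open>The product form lets the total mass factor into one-dimensional normal
  integrals.\<close>

lemma std_gaussian_density_eq_prod:
  fixes x :: "real ^ 'n::finite"
  shows "(2 * pi) powr (- real CARD('n) / 2) * exp (- (norm x)\<^sup>2 / 2) =
    (\<Prod>b\<in>Basis. std_normal_density (x \<bullet> b))"
proof -
  have "(\<Prod>b\<in>Basis. std_normal_density (x \<bullet> b)) =
      (1 / sqrt (2 * pi)) ^ CARD('n) * exp (\<Sum>b\<in>Basis. - (x \<bullet> b)\<^sup>2 / 2)"
    by (simp add: std_normal_density_def prod_dividef exp_sum power_divide)
  also have "(\<Sum>b\<in>Basis. - (x \<bullet> b)\<^sup>2 / 2) = - (norm x)\<^sup>2 / 2"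
    unfolding power2_norm_eq_inner euclidean_inner[of x x]
    by (simp add: sum_negf sum_divide_distrib power2_eq_square)
  also have "(1 / sqrt (2 * pi)) ^ CARD('n) = (2 * pi) powr (- real CARD('n) / 2)"
    by (simp add: powr_half_sqrt[symmetric] powr_realpow[symmetric] powr_powr powr_minus_divide
      power_one_over)
  finally show ?thesis by simp
qed

lemma prob_space_std_gaussian: "prob_space (std_gaussian :: (real ^ 'n::finite) measure)"
proof
  have "emeasure (std_gaussian :: (real ^ 'n) measure) (space std_gaussian) =
      (\<integral>\<^sup>+x. (\<Prod>b\<in>Basis. ennreal (std_normal_density (x \<bullet> b))) \<partial>(lborel :: (real ^ 'n) measure))"
    unfolding std_gaussian_def std_gaussian_density_eq_prod
    by (simp add: emeasure_density prod_ennreal)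
  also have "\<dots> = (\<Prod>b\<in>(Basis :: (real ^ 'n) set). \<integral>\<^sup>+x. ennreal (std_normal_density x) \<partial>lborel)"
    by (rule nn_integral_lborel_prod) auto
  also have "(\<integral>\<^sup>+x. ennreal (std_normal_density x) \<partial>lborel) = 1"
    by (subst nn_integral_eq_integral) auto
  finally show "emeasure (std_gaussian :: (real ^ 'n) measure) (space std_gaussian) = 1"
    by simp
qed

section \<open>The inequality on a probability space\<close>

text \<open>\<open>F\<close> stands for f / m. Since it has mean 1, it is a probability density, and
  \<open>J r\<close> averages g_r(ln F) under it; the bounds \<open>c\<close> and \<open>C\<close>
  give integrability.\<close>

lemma (in prob_space) integral_exp_primitive_le:
  fixes F :: "'a \<Rightarrow> real"
  assumes [measurable]: "F \<in> borel_measurable M"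
    and F: "\<And>x. c \<le> F x" "\<And>x. F x \<le> C" "0 < c" and EF: "expectation F = 1"
    and pq: "0 < p" "p < q"
  defines "J \<equiv> \<lambda>r. \<integral>x. F x * exp_primitive r (ln (F x)) \<partial>M"
  shows "0 \<le> J q" "J p \<le> J q powr (p / q)"
proof -
  have Fpos: "0 < F x" for x using F(1)[of x] F(3) by linarith
  have lnF: "ln c \<le> ln (F x)" "ln (F x) \<le> ln C" for x
    using F Fpos[of x] order.trans[OF F(1,2)] by (auto intro!: ln_mono)
  have [measurable]: "exp_primitive r \<in> borel_measurable borel" for r
    by (intro borel_measurable_continuous_onI continuous_on_exp_primitive)
  have intF: "integrable M F"
    by (rule integrable_const_bound[of _ C]) (use F Fpos in \<open>auto simp: less_imp_le\<close>)
  have int: "integrable M (\<lambda>x. F x * exp_primitive r (ln (F x)))" for r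
  proof (rule integrable_const_bound)
    show "AE x in M. norm (F x * exp_primitive r (ln (F x))) \<le>
        C * max \<bar>exp_primitive r (ln c)\<bar> \<bar>exp_primitive r (ln C)\<bar>"
    proof (rule AE_I2)
      fix x
      have "\<bar>exp_primitive r (ln (F x))\<bar> \<le> max \<bar>exp_primitive r (ln c)\<bar> \<bar>exp_primitive r (ln C)\<bar>"
        using exp_primitive_mono[OF lnF(1), of r x] exp_primitive_mono[OF lnF(2), of r x] by linarith
      then show "norm (F x * exp_primitive r (ln (F x))) \<le>
          C * max \<bar>exp_primitive r (ln c)\<bar> \<bar>exp_primitive r (ln C)\<bar>"
        using Fpos[of x] F(2)[of x] by (auto simp: abs_mult intro!: mult_mono)
    qed
  qed measurable
  \<comment> \<open>The only form of Jensen's inequality needed: affine bounds survive averaging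
    with the weight \<open>F\<close>.\<close>
  have J_le: "J r \<le> A + B * J s"
    if "\<And>t. exp_primitive r t \<le> A + B * exp_primitive s t" for r s A B
  proof -
    have "J r \<le> (\<integral>x. A * F x + B * (F x * exp_primitive s (ln (F x))) \<partial>M)"
      unfolding J_def
    proof (rule integral_mono)
      fix x
      have "F x * exp_primitive r (ln (F x)) \<le> F x * (A + B * exp_primitive s (ln (F x)))"
        using that Fpos[of x] by (intro mult_left_mono) auto
      then show "F x * exp_primitive r (ln (F x)) \<le> A * F x + B * (F x * exp_primitive s (ln (F x)))"
        by (simp add: algebra_simps)
    qed (use int intF in auto)
    also have "\<dots> = A + B * J s"
      using int intF EF by (simp add: J_def)
    finally show ?thesis .
  qed
  \<comment> \<open>At r = 0 the integrand is F(1 - 1/F) = F - 1, of mean 0. The tangent at 0 gives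
    g_0 \<le> g_q, whence J q \<ge> 0.\<close>
  have "J 0 = (\<integral>x. F x - 1 \<partial>M)"
    unfolding J_def exp_primitive_0_left
    by (rule Bochner_Integration.integral_cong)
       (use Fpos in \<open>auto simp: exp_minus field_simps less_imp_neq[symmetric]\<close>)
  then have "J 0 = 0"
    using intF EF by (simp add: prob_space)
  then show J_nonneg: "0 \<le> J q"
    using J_le[of 0 0 1 q] exp_primitive_concave[of 0 q _ 0] pq by simp
  have "expectation F \<le> C"
    using intF F by (intro integral_le_const) auto
  then have "1 \<le> C" using EF by simp
  have "J q \<le> (\<integral>x. exp_primitive q (ln C) * F x \<partial>M)"
    unfolding J_def
    using int intF Fpos exp_primitive_mono[OF lnF(2)]
    by (intro integral_mono) (auto simp: mult.commute less_imp_le intro!: mult_right_mono)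
  then have "J q \<le> exp_primitive q (ln C)"
    using EF by simp
  \<comment> \<open>\<open>J q\<close> lies between the values of g_q at 0 and at ln C, where ln C
    \<ge> 0.\<close>
  then obtain u where u: "0 \<le> u" "exp_primitive q u = J q"
    using IVT'[of "exp_primitive q" 0 "J q" "ln C"] J_nonneg \<open>1 \<le> C\<close> continuous_on_exp_primitive
    by auto
  \<comment> \<open>The tangent at \<open>u\<close>, evaluated at its own contact point
    \<open>J q\<close>, returns g_p(u).\<close>
  have "J p \<le> (exp_primitive p u - exp ((p - q) * u) * J q) + exp ((p - q) * u) * J q"
    using exp_primitive_concave[of p q _ u] pq u
    by (intro J_le) (simp add: algebra_simps)
  also have "\<dots> \<le> J q powr (p / q)"
    using exp_primitive_le_powr[OF pq u(1)] u(2) by simp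
  finally show "J p \<le> J q powr (p / q)" .
qed

text \<open>With F = f / m, F g_r(ln F) is (F^r - F)/(r-1) for r \<noteq> 1 and F ln F for r = 1.
  The factor m^r reflects homogeneity of degree r.\<close>

lemma I_fun_eq_exp_primitive:
  fixes f :: "real ^ 'n::finite \<Rightarrow> real"
  assumes [measurable]: "f \<in> borel_measurable borel"
    and f: "\<And>x. c \<le> f x" "\<And>x. f x \<le> C" "0 < c" and "0 < r"
  defines "m \<equiv> \<integral>x. f x \<partial>std_gaussian"
  shows "I_fun r f = m powr r * (\<integral>x. f x / m * exp_primitive r (ln (f x / m)) \<partial>std_gaussian)"
proof -
  interpret prob_space "std_gaussian :: (real ^ 'n) measure"
    by (rule prob_space_std_gaussian)
  have [measurable_cong]: "sets (std_gaussian :: (real ^ 'n) measure) = sets borel"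
    by (simp add: std_gaussian_def)
  have fpos: "0 < f x" for x using f(1)[of x] f(3) by linarith
  have intf: "integrable std_gaussian f"
    by (rule integrable_const_bound[of _ C]) (use f fpos in \<open>auto simp: less_imp_le\<close>)
  have "c \<le> m" unfolding m_def using intf f by (intro integral_ge_const) auto
  then have m: "0 < m" using f by simp
  have g1: "gnorm 1 f = m"
    using m fpos by (simp add: gnorm_def m_def less_imp_le abs_of_pos)
  show ?thesis
  proof (cases "r = 1")
    case True
    then show ?thesis
      using m by (simp add: I_fun_def g1 exp_primitive_def)
  next
    case False
    have intr: "integrable std_gaussian (\<lambda>x. f x powr r)"
      by (rule integrable_const_bound[of _ "C powr r"])
         (use f fpos \<open>0 < r\<close> in \<open>auto simp: less_imp_le intro!: powr_mono2\<close>)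
    have "f x / m * exp_primitive r (ln (f x / m)) = (f x powr r / m powr r - f x / m) / (r - 1)" for x
    proof -
      have "exp ((r - 1) * ln (f x / m)) = (f x / m) powr (r - 1)"
        using fpos[of x] m by (simp add: powr_def)
      also have "f x / m * \<dots> = f x powr r / m powr r"
        using fpos[of x] m by (simp add: powr_diff powr_divide field_simps)
      finally show ?thesis
        using False by (simp add: exp_primitive_def right_diff_distrib)
    qed
    then have "(\<integral>x. f x / m * exp_primitive r (ln (f x / m)) \<partial>std_gaussian) =
        ((\<integral>x. f x powr r \<partial>std_gaussian) / m powr r - 1) / (r - 1)"
      using intf intr m by (simp add: m_def[symmetric])
    moreover have "gnorm r f powr r = (\<integral>x. f x powr r \<partial>std_gaussian)"
      using fpos \<open>0 < r\<close> by (simp add: gnorm_def powr_powr less_imp_le abs_of_pos)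
    ultimately show ?thesis
      using False m by (simp add: I_fun_def g1 field_simps)
  qed
qed

theorem theorem4p1:
  fixes p q :: real and f :: "real ^ 'n::finite \<Rightarrow> real"
  assumes "0 < p" and "p < q" and "f \<in> Cb_infinity_const_plus"
  shows "I_fun p f \<le>
    Gamma (1 + 1 / q) / Gamma (1 + 1 / q - p / q) * q powr (p / q) * I_fun q f powr (p / q)"
proof -
  interpret prob_space "std_gaussian :: (real ^ 'n) measure"
    by (rule prob_space_std_gaussian)
  have [measurable_cong]: "sets (std_gaussian :: (real ^ 'n) measure) = sets borel"
    by (simp add: std_gaussian_def)
  obtain g c where g: "g \<in> Cb_infinity" "\<And>x. 0 \<le> g x" "0 < c" "f = (\<lambda>x. g x + c)"
    using assms(3) by (auto simp: Cb_infinity_const_plus_def)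
  \<comment> \<open>Level 0 of \<open>C_k\<close> gives continuity, hence measurability; below, the
    empty index list gives the bound on \<open>g\<close>.\<close>
  have "C_k 0 g" using g(1) unfolding Cb_infinity_def by blast
  then have f_meas [measurable]: "f \<in> borel_measurable borel"
    unfolding g(4) by (intro borel_measurable_continuous_onI continuous_intros) simp
  have "bounded (range (iterated_partial [] g))"
    using g(1) unfolding Cb_infinity_def by blast
  then obtain B where B: "\<And>x. \<bar>g x\<bar> \<le> B"
    by (auto simp: bounded_iff)
  define C where "C = B + c"
  have f: "c \<le> f x" "f x \<le> C" for x
    using g(2)[of x] B[of x] by (simp_all add: g(4) C_def)
  define m where "m = (\<integral>x. f x \<partial>std_gaussian)"
  have intf: "integrable std_gaussian f"
  proof (rule integrable_const_bound)
    show "AE x in std_gaussian. norm (f x) \<le> C"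
      using f \<open>0 < c\<close> by (intro AE_I2) (smt (verit) real_norm_def)
  qed measurable
  have "c \<le> m" unfolding m_def using intf f by (intro integral_ge_const) auto
  then have m: "0 < m" using g(3) by simp
  define J where "J = (\<lambda>r. \<integral>x. f x / m * exp_primitive r (ln (f x / m)) \<partial>std_gaussian)"
  have I: "I_fun r f = m powr r * J r" if "0 < r" for r
    unfolding J_def m_def by (rule I_fun_eq_exp_primitive[OF f_meas f g(3) that])
  have "expectation (\<lambda>x. f x / m) = 1"
    using m by (simp add: m_def[symmetric])
  note J = integral_exp_primitive_le[of "\<lambda>x. f x / m" "c / m" "C / m", OF _ _ _ _ this assms(1,2)]
  have J_nonneg: "0 \<le> J q" and J_le: "J p \<le> J q powr (p / q)"
    unfolding J_def using f m g(3) by (intro J; simp add: divide_right_mono)+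
  have "I_fun p f \<le> m powr p * J q powr (p / q)"
    using J_le assms(1) by (simp add: I mult_left_mono)
  \<comment> \<open>Both sides scale alike: m^p = (m^q)^(p/q).\<close>
  also have "\<dots> = I_fun q f powr (p / q)"
    using assms m J_nonneg by (simp add: I powr_mult powr_powr)
  finally have "I_fun p f \<le> I_fun q f powr (p / q)" .
  also have "\<dots> = 1 * I_fun q f powr (p / q)" by simp
  \<comment> \<open>Splitting 1 this way exposes the factor that the Gamma quotient
    dominates.\<close>
  also have "1 = (1 / q) powr (p / q) * q powr (p / q)"
    using assms by (simp add: powr_mult[symmetric])
  also have "(1 / q) powr (p / q) * q powr (p / q) * I_fun q f powr (p / q) \<le>
      Gamma (1 + 1 / q) / Gamma (1 + 1 / q - p / q) * q powr (p / q) * I_fun q f powr (p / q)"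
    using assms by (intro mult_right_mono Gamma_ratio_ge_powr) auto
  finally show ?thesis .
qed

end
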